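(* Let $G$ be a graph, $\chi := \chi(G)$, $\chi' := \chi'(G)$, $\Delta := \Delta(G)$, and for each integer $\ell \geqslant 0$ let $\chi_\ell(G) := \chi(\mathbb{L}_\ell(G))$ be the chromatic number of the $\ell$-link graph of $G$. Then: (1) If $\ell \geqslant 0$ is even, then $\chi_\ell(G) \leqslant \min\{\chi, \lfloor(\frac{2}{3})^{\ell/2}(\chi - 3)\rfloor + 3\}$. (2) If $\ell \geqslant 1$ is odd, then $\chi_\ell(G) \leqslant \min\{\chi', \lfloor(\frac{2}{3})^{\frac{\ell - 1}{2}}(\chi' - 3)\rfloor + 3\}$. (3) If $\ell \geqslant 0$ and $\ell \neq 1$, then $\chi_\ell(G) \leqslant \Delta + 1$. (4) If $\ell \geqslant 2$, then $\chi_\ell(G) \leqslant \chi_{\ell - 2}(G)$.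
   Context: All graphs are finite, undirected and loopless; parallel edges are allowed. For an integer $\ell \geqslant 0$, an $\ell$-arc of $G$ is an alternating sequence $\vec{L} = (v_0, e_1, v_1, \ldots, e_\ell, v_\ell)$ of vertices and edges of $G$ such that $e_i$ has end vertices $v_{i-1}, v_i$ for $1 \leqslant i \leqslant \ell$, and $e_i \neq e_{i+1}$ for $1 \leqslant i \leqslant \ell - 1$ (vertices and non-consecutive edges may repeat). An $\ell$-link is an $\ell$-arc identified with its reverse sequence, written $L = [v_0, e_1, \ldots, e_\ell, v_\ell]$. For an $\ell$-arc $\vec{L}$ and $0 \leqslant i \leqslant j \leqslant \ell$, $\vec{L}[i,j]$ is the $(j-i)$-link $[v_i, e_{i+1}, \ldots, e_j, v_j]$. The $\ell$-link graph $\mathbb{L}_\ell(G)$ has as vertices the $\ell$-links of $G$, and the number of edges between two $\ell$-links $L, R$ is the number of $(\ell+1)$-links $Q$ of $G$ such that $\{\vec{Q}[0,\ell], \vec{Q}[1,\ell+1]\} = \{L, R\}$ ($\vec Q$ being either of the two $(\ell+1)$-arcs representing $Q$; the two $\ell$-links $\vec{Q}[0,\ell]$ and $\vec{Q}[1,\ell+1]$ are always distinct, so $\mathbb{L}_\ell(G)$ is loopless). In particular $\mathbb{L}_0(G) = G$. $\chi(G)$ is the chromatic number; $\chi'(G)$ is the edge-chromatic number (least number of colours on edges so that distinct edges sharing an end vertex get different colours); $\Delta(G)$ is the maximum degree, counting parallel edges with multiplicity. *)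

theory Defs
  imports Complex_Main
begin

record ('v, 'e) multigraph =
  verts :: "'v set"
  edges :: "'e set"
  ends :: "'e \<Rightarrow> 'v set"

text \<open>Two ends per edge exclude loops; distinct edges may have the same ends.
  The null graph is allowed, since a link graph may have no vertices.\<close>

locale fin_multigraph =
  fixes G :: "('v, 'e) multigraph"
  assumes finite_verts: "finite (verts G)"
    and finite_edges: "finite (edges G)"
    and ends_subset: "e \<in> edges G \<Longrightarrow> ends G e \<subseteq> verts G"
    and card_ends: "e \<in> edges G \<Longrightarrow> card (ends G e) = 2"

definition proper_colouring :: "('v, 'e) multigraph \<Rightarrow> nat \<Rightarrow> ('v \<Rightarrow> nat) \<Rightarrow> bool" where
  "proper_colouring G k c \<longleftrightarrow>
     (\<forall>v\<in>verts G. c v < k) \<and>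
     (\<forall>e\<in>edges G. \<forall>u v. ends G e = {u, v} \<longrightarrow> c u \<noteq> c v)"

definition chromatic_number :: "('v, 'e) multigraph \<Rightarrow> nat" where
  "chromatic_number G = (LEAST k. \<exists>c. proper_colouring G k c)"

definition proper_edge_colouring :: "('v, 'e) multigraph \<Rightarrow> nat \<Rightarrow> ('e \<Rightarrow> nat) \<Rightarrow> bool" where
  "proper_edge_colouring G k c \<longleftrightarrow>
     (\<forall>e\<in>edges G. c e < k) \<and>
     (\<forall>e\<in>edges G. \<forall>f\<in>edges G. e \<noteq> f \<longrightarrow> ends G e \<inter> ends G f \<noteq> {} \<longrightarrow> c e \<noteq> c f)"

definition edge_chromatic_number :: "('v, 'e) multigraph \<Rightarrow> nat" where
  "edge_chromatic_number G = (LEAST k. \<exists>c. proper_edge_colouring G k c)"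

definition degree :: "('v, 'e) multigraph \<Rightarrow> 'v \<Rightarrow> nat" where
  "degree G v = card {e \<in> edges G. v \<in> ends G e}"

text \<open>The element 0 matters only for the null graph, whose maximum degree is 0 by convention.\<close>

definition max_degree :: "('v, 'e) multigraph \<Rightarrow> nat" where
  "max_degree G = Max (insert 0 (degree G ` verts G))"

text \<open>The sequence $(v_0, e_1, v_1, \ldots, e_\ell, v_\ell)$ is stored as the pair of lists
  $([v_0, \ldots, v_\ell], [e_1, \ldots, e_\ell])$, so position $i$ of the second list
  is $e_{i+1}$.\<close>

type_synonym ('v, 'e) arc = "'v list \<times> 'e list"

definition is_arc :: "('v, 'e) multigraph \<Rightarrow> nat \<Rightarrow> ('v, 'e) arc \<Rightarrow> bool" where
  "is_arc G l a \<longleftrightarrow> (case a of (vs, es) \<Rightarrow>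
     length vs = l + 1 \<and> length es = l \<and>
     set vs \<subseteq> verts G \<and> set es \<subseteq> edges G \<and>
     (\<forall>i<l. ends G (es ! i) = {vs ! i, vs ! (i + 1)}) \<and>
     (\<forall>i. i + 1 < l \<longrightarrow> es ! i \<noteq> es ! (i + 1)))"

definition rev_arc :: "('v, 'e) arc \<Rightarrow> ('v, 'e) arc" where
  "rev_arc a = (rev (fst a), rev (snd a))"

definition subarc :: "('v, 'e) arc \<Rightarrow> nat \<Rightarrow> nat \<Rightarrow> ('v, 'e) arc" where
  "subarc a i j = (take (j - i + 1) (drop i (fst a)), take (j - i) (drop i (snd a)))"

type_synonym ('v, 'e) link = "('v, 'e) arc set"

definition link_of :: "('v, 'e) arc \<Rightarrow> ('v, 'e) link" where
  "link_of a = {a, rev_arc a}"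

definition links :: "nat \<Rightarrow> ('v, 'e) multigraph \<Rightarrow> ('v, 'e) link set" where
  "links l G = {link_of a | a. is_arc G l a}"

text \<open>The ends of an edge $Q$ are collected over both arcs representing $Q$. The two arcs give the
  same pair of links, see \<open>ends_link_graph\<close> below.\<close>

definition link_graph ::
  "nat \<Rightarrow> ('v, 'e) multigraph \<Rightarrow> (('v, 'e) link, ('v, 'e) link) multigraph" where
  "link_graph l G =
     \<lparr> verts = links l G,
       edges = links (l + 1) G,
       ends = (\<lambda>Q. \<Union>a\<in>Q. {link_of (subarc a 0 l), link_of (subarc a 1 (l + 1))}) \<rparr>"

definition link_chromatic_number :: "nat \<Rightarrow> ('v, 'e) multigraph \<Rightarrow> nat" where
  "link_chromatic_number l G = chromatic_number (link_graph l G)"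

lemma rev_arc_rev_arc [simp]: "rev_arc (rev_arc a) = a"
  by (simp add: rev_arc_def)

lemma link_of_rev_arc [simp]: "link_of (rev_arc a) = link_of a"
  by (auto simp: link_of_def)

lemma subarc_rev_arc:
  assumes "is_arc G (l + 1) a"
  shows "subarc (rev_arc a) 0 l = rev_arc (subarc a 1 (l + 1))"
    and "subarc (rev_arc a) 1 (l + 1) = rev_arc (subarc a 0 l)"
  using assms
  by (auto simp: is_arc_def subarc_def rev_arc_def take_rev drop_rev
      split: prod.splits)

lemma ends_link_graph:
  assumes "is_arc G (l + 1) a"
  shows "ends (link_graph l G) (link_of a) =
    {link_of (subarc a 0 l), link_of (subarc a 1 (l + 1))}"
proof -
  have "ends (link_graph l G) (link_of a) =
    {link_of (subarc a 0 l), link_of (subarc a 1 (l + 1)),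
     link_of (subarc (rev_arc a) 0 l), link_of (subarc (rev_arc a) 1 (l + 1))}"
    by (auto simp: link_graph_def link_of_def [of a])
  then show ?thesis
    unfolding subarc_rev_arc [OF assms] by auto
qed

lemma is_arc_subarc:
  assumes "is_arc G (l + 1) a"
  shows "is_arc G l (subarc a 0 l)" "is_arc G l (subarc a 1 (l + 1))"
  using assms
  by (auto simp: is_arc_def subarc_def nth_append dest: in_set_takeD in_set_dropD
      split: prod.splits)

lemma (in fin_multigraph) subarc_links_distinct:
  assumes "is_arc G (l + 1) a"
  shows "link_of (subarc a 0 l) \<noteq> link_of (subarc a 1 (l + 1))"
proof
  assume eq: "link_of (subarc a 0 l) = link_of (subarc a 1 (l + 1))"
  obtain vs es where a: "a = (vs, es)" by (cases a)
  have len: "length vs = l + 2" "length es = l + 1"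
    and en: "\<And>i. i \<le> l \<Longrightarrow> ends G (es ! i) = {vs ! i, vs ! (i + 1)}"
    and es: "\<And>i. i \<le> l \<Longrightarrow> es ! i \<in> edges G"
    and nb: "\<And>i. i < l \<Longrightarrow> es ! i \<noteq> es ! (i + 1)"
    using assms by (auto simp: is_arc_def a)
  have nl: "vs ! i \<noteq> vs ! (i + 1)" if "i \<le> l" for i
    using card_ends [OF es [OF that]] en [OF that] by auto
  from eq consider "subarc a 0 l = subarc a 1 (l + 1)"
    | "subarc a 0 l = rev_arc (subarc a 1 (l + 1))"
    by (auto simp: link_of_def doubleton_eq_iff)
  then show False
  proof cases
    case 1
    then have "take (l + 1) vs ! 0 = take (l + 1) (drop 1 vs) ! 0"
      by (simp add: subarc_def a)
    then show False using nl [of 0] len by simp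
  next
    case 2
    then have v: "take (l + 1) vs = rev (drop 1 vs)" and e: "take l es = rev (drop 1 es)"
      using len by (auto simp: subarc_def rev_arc_def a)
    have vi: "vs ! i = vs ! (l + 1 - i)" if "i \<le> l" for i
      using arg_cong [OF v, of "\<lambda>xs. xs ! i"] that len by (simp add: rev_nth Suc_diff_le)
    have ei: "es ! i = es ! (l - i)" if "i < l" for i
      using arg_cong [OF e, of "\<lambda>xs. xs ! i"] that len by (simp add: rev_nth Suc_diff_Suc)
    show False
    proof (cases "even l")
      case True
      then obtain m where "l = 2 * m" by blast
      then show False using vi [of m] nl [of m] by simp
    next
      case False
      then obtain m where "l = 2 * m + 1" by (elim oddE)
      then show False using ei [of m] nb [of m] by simp
    qed
  qed
qed

lemma (in fin_multigraph) finite_links: "finite (links l G)"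
proof -
  have "{a. is_arc G l a} \<subseteq> {vs. set vs \<subseteq> verts G \<and> length vs = l + 1} \<times>
      {es. set es \<subseteq> edges G \<and> length es = l}"
    by (auto simp: is_arc_def)
  then have "finite {a. is_arc G l a}"
    using finite_lists_length_eq [OF finite_verts] finite_lists_length_eq [OF finite_edges]
    by (meson finite_SigmaI finite_subset)
  moreover have "links l G = link_of ` {a. is_arc G l a}"
    by (auto simp: links_def)
  ultimately show ?thesis by simp
qed

lemma (in fin_multigraph) fin_multigraph_link_graph: "fin_multigraph (link_graph l G)"
proof
  show "finite (verts (link_graph l G))" "finite (edges (link_graph l G))"
    by (simp_all add: link_graph_def finite_links)
next
  fix Q assume "Q \<in> edges (link_graph l G)"
  then obtain a where a: "is_arc G (l + 1) a" "Q = link_of a"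
    by (auto simp: link_graph_def links_def)
  show "ends (link_graph l G) Q \<subseteq> verts (link_graph l G)"
    unfolding a(2) ends_link_graph [OF a(1)]
    using is_arc_subarc [OF a(1)] unfolding link_graph_def links_def by (simp del: split_paired_Ex) blast
  show "card (ends (link_graph l G) Q) = 2"
    unfolding a(2) ends_link_graph [OF a(1)]
    using subarc_links_distinct [OF a(1)] by simp
qed

end

theory Submission
  imports Defs "HOL-Combinatorics.Transposition"
begin

text \<open>Colourings of a link graph correspond to colourings of \<open>l\<close>-arcs that are invariant under
  reversal and separate the two \<open>l\<close>-subarcs of every \<open>(l + 1)\<close>-arc. Everything rests on
  comparing such colourings for \<open>l\<close> and for \<open>l + 2\<close>. An \<open>(l + 2)\<close>-arc contains three consecutive
  \<open>l\<close>-arcs \<open>A\<close>, \<open>B\<close>, \<open>C\<close>, and an \<open>(l + 3)\<close>-arc contains four of them, \<open>A\<close>, \<open>B\<close>, \<open>C\<close>, \<open>D\<close>; the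
  \<open>(l + 2)\<close>-arcs at its two ends see \<open>(A, B, C)\<close> and \<open>(B, C, D)\<close>, and \<open>B\<close>, \<open>C\<close> are adjacent in the
  \<open>l\<close>-link graph.

  Giving an \<open>(l + 2)\<close>-arc the colour of its middle \<open>B\<close> is therefore proper, which is the
  monotonicity \<open>link_chromatic_number_mono\<close>. Looking at \<open>A\<close> and \<open>C\<close> as well saves about a third of
  the colours. Group the colours into triples. In each triple the third colour is abolished: where
  \<open>B\<close> has it, \<open>B\<close> takes over whichever of the first two colours is absent
  from \<open>A\<close> and \<open>C\<close>. If both are present, then one colour shared by all triples serves, because
  then the colours of \<open>A\<close> and \<open>C\<close> are among those that are kept. Hence \<open>k\<close> colours for \<open>l\<close> give
  \<open>2 * k div 3 + 1\<close> colours for \<open>l + 2\<close> (\<open>arc_colouring_thin\<close>). Read as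
  \<open>\<chi>' - 3 \<le> 2/3 (\<chi> - 3)\<close>, this iterates to the geometric bound, starting from vertex colourings at
  \<open>l = 0\<close> and edge colourings at \<open>l = 1\<close> (\<open>link_chromatic_number_decay\<close>).

  For the bound by the maximum degree \<open>\<Delta>\<close>, monotonicity leaves only \<open>l = 0\<close> and \<open>l = 3\<close>. The first
  is greedy colouring. For the second, Shannon's theorem colours the edges of a multigraph
  with \<open>\<lfloor>3\<Delta>/2\<rfloor>\<close> colours (\<open>shannon_edge_colouring\<close>), and one thinning step from \<open>l = 1\<close> to \<open>l = 3\<close>
  turns these into at most \<open>\<Delta> + 1\<close>.\<close>

section \<open>Vertex colourings\<close>

lemma chromatic_number_le:
  assumes "proper_colouring G k c"
  shows "chromatic_number G \<le> k"
  unfolding chromatic_number_def using assms by (intro Least_le) blast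

context fin_multigraph
begin

lemma degree_le_max_degree:
  "v \<in> verts G \<Longrightarrow> degree G v \<le> max_degree G"
  unfolding max_degree_def using finite_verts by (intro Max_ge) auto

lemma edge_endsE:
  assumes "e \<in> edges G"
  obtains x y where "ends G e = {x, y}" "x \<noteq> y" "x \<in> verts G" "y \<in> verts G"
  using card_ends[OF assms] ends_subset[OF assms] by (auto simp: card_2_iff)

lemma greedy_colouring:
  "\<exists>c. proper_colouring G (max_degree G + 1) c"
proof -
  have "\<exists>c. (\<forall>v\<in>W. c v < max_degree G + 1) \<and>
      (\<forall>e\<in>edges G. \<forall>u\<in>W. \<forall>v\<in>W. ends G e = {u, v} \<longrightarrow> c u \<noteq> c v)"
    if "W \<subseteq> verts G" for W
    using finite_subset[OF that finite_verts] that
  proof (induction W rule: finite_induct)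
    case empty
    show ?case by simp
  next
    case (insert w W)
    then obtain c :: "'v \<Rightarrow> nat" where c: "\<forall>v\<in>W. c v < max_degree G + 1"
      "\<forall>e\<in>edges G. \<forall>u\<in>W. \<forall>v\<in>W. ends G e = {u, v} \<longrightarrow> c u \<noteq> c v"
      by auto
    let ?E = "{e \<in> edges G. w \<in> ends G e}"
    \<comment> \<open>The colours of the neighbours of \<open>w\<close>: an edge at \<open>w\<close> contributes that of its other end,
      which may be a junk value when that end is outside \<open>W\<close>.\<close>
    define N where "N = (\<lambda>e. c (THE v. v \<in> ends G e \<and> v \<noteq> w)) ` ?E"
    have "card N \<le> card ?E"
      unfolding N_def using finite_edges by (intro card_image_le) simp
    also have "\<dots> \<le> max_degree G"
      using degree_le_max_degree[of w] insert.prems by (simp add: degree_def)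
    finally have "card N < card {..<max_degree G + 1}" by simp
    moreover have "finite N" using finite_edges by (simp add: N_def)
    ultimately obtain i where i: "i < max_degree G + 1" "i \<notin> N"
      by (metis card_mono leD lessThan_iff subsetI)
    have nb: "c v \<noteq> i" if "e \<in> edges G" "ends G e = {w, v}" for e v
    proof -
      have "v \<noteq> w" using card_ends[OF that(1)] that(2) by auto
      then have "(THE u. u \<in> ends G e \<and> u \<noteq> w) = v"
        unfolding that(2) by (intro the_equality) auto
      then have "c v \<in> N" unfolding N_def using that by force
      then show ?thesis using i(2) by blast
    qed
    have loop: "u \<noteq> v" if "e \<in> edges G" "ends G e = {u, v}" for e u v
      using card_ends[OF that(1)] that(2) by auto
    have "\<forall>v\<in>insert w W. (c(w := i)) v < max_degree G + 1"
      using c(1) i(1) by simp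
    moreover have "(c(w := i)) u \<noteq> (c(w := i)) v"
      if "e \<in> edges G" "u \<in> insert w W" "v \<in> insert w W" "ends G e = {u, v}" for e u v
      using that nb[of e u] nb[of e v] loop[of e u v] c(2) by (auto simp: insert_commute)
    ultimately show ?case by blast
  qed
  from this[of "verts G"] show ?thesis
    unfolding proper_colouring_def using ends_subset by (metis insert_subset order_refl)
qed

lemma chromatic_number_le_max_degree: "chromatic_number G \<le> max_degree G + 1"
  using greedy_colouring chromatic_number_le by blast

lemma optimal_colouring: "\<exists>c. proper_colouring G (chromatic_number G) c"
  unfolding chromatic_number_def by (rule LeastI_ex) (use greedy_colouring in blast)

end

section \<open>Edge colourings of multigraphs\<close>

abbreviation restrict_edges :: "('v, 'e) multigraph \<Rightarrow> 'e set \<Rightarrow> ('v, 'e) multigraph" where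
  "restrict_edges G F \<equiv> G\<lparr>edges := F\<rparr>"

definition missing :: "('v, 'e) multigraph \<Rightarrow> nat \<Rightarrow> ('e \<Rightarrow> nat) \<Rightarrow> 'v \<Rightarrow> nat set" where
  "missing G k c v = {i. i < k \<and> (\<forall>e\<in>edges G. v \<in> ends G e \<longrightarrow> c e \<noteq> i)}"

lemma finite_missing [simp]: "finite (missing G k c v)"
  by (simp add: missing_def)

lemma colour_new_edge:
  assumes "proper_edge_colouring (restrict_edges G F) k c" "e \<notin> F" "ends G e = {x, y}"
    and "i \<in> missing (restrict_edges G F) k c x" "i \<in> missing (restrict_edges G F) k c y"
  shows "proper_edge_colouring (restrict_edges G (insert e F)) k (c(e := i))"
  using assms unfolding proper_edge_colouring_def missing_def by (auto 0 3)

context fin_multigraph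
begin

lemma card_missing:
  assumes "proper_edge_colouring G k c"
  shows "k \<le> card (missing G k c v) + degree G v"
proof -
  let ?E = "{e \<in> edges G. v \<in> ends G e}"
  have "{..<k} \<subseteq> missing G k c v \<union> c ` ?E" by (auto simp: missing_def)
  then have "k \<le> card (missing G k c v \<union> c ` ?E)"
    using card_mono[of "missing G k c v \<union> c ` ?E" "{..<k}"] finite_edges by simp
  also have "\<dots> \<le> card (missing G k c v) + card (c ` ?E)" by (rule card_Un_le)
  also have "card (c ` ?E) \<le> card ?E" using finite_edges by (intro card_image_le) simp
  finally show ?thesis by (simp add: degree_def)
qed

text \<open>The edges of one colour form a matching, so inside \<open>T\<close> they cover an even number of vertices, and
  they avoid every vertex where that colour is missing. Used for two colours at once, this bounds
  the number of edges in a Kempe component by its number of vertices.\<close>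

lemma colour_class_inside:
  assumes c: "proper_edge_colouring G k c" and T: "finite T"
    and B: "B \<subseteq> T" "\<And>v. v \<in> B \<Longrightarrow> i \<in> missing G k c v"
  shows "2 * card {e \<in> edges G. c e = i \<and> ends G e \<subseteq> T} + card B \<le> card T"
proof -
  let ?M = "{e \<in> edges G. c e = i \<and> ends G e \<subseteq> T}"
  have "card (\<Union>e\<in>?M. ends G e) = (\<Sum>e\<in>?M. card (ends G e))"
  proof (rule card_UN_disjoint)
    show "finite ?M" using finite_edges by simp
    show "\<forall>e\<in>?M. finite (ends G e)" using T finite_subset by blast
    show "\<forall>e\<in>?M. \<forall>f\<in>?M. e \<noteq> f \<longrightarrow> ends G e \<inter> ends G f = {}"
      using c unfolding proper_edge_colouring_def by blast
  qed
  also have "\<dots> = 2 * card ?M" using card_ends by simp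
  finally have M: "card (\<Union>e\<in>?M. ends G e) = 2 * card ?M" .
  have "(\<Union>e\<in>?M. ends G e) \<subseteq> T - B" using B(2) by (auto simp: missing_def)
  then have "card (\<Union>e\<in>?M. ends G e) \<le> card (T - B)" using T by (intro card_mono) auto
  also have "\<dots> = card T - card B" using B(1) T by (meson card_Diff_subset finite_subset)
  finally show ?thesis using M card_mono[OF T B(1)] by linarith
qed

text \<open>Components of the subgraph formed by two colours are paths and cycles, so a component cannot
  have three vertices of degree at most one; the component of \<open>y\<close> thus misses \<open>x\<close> or \<open>z\<close>. Paths
  need not be followed, for counting suffices. A component has at least \<open>card T - 1\<close> edges, and a maximal
  set \<open>T\<close> containing \<open>y\<close> with that many edges is closed under the two colours, since adding the far end
  of a leaving edge would keep the property. But the three deficient vertices would force the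
  number of edges below \<open>card T - 1\<close>.\<close>

lemma kempe_separation:
  assumes c: "proper_edge_colouring G k c"
    and y: "y \<in> verts G" and "x \<noteq> z" "b \<noteq> g"
    and mx: "g \<in> missing G k c x" and mz: "g \<in> missing G k c z"
    and my: "b \<in> missing G k c y"
  obtains T where "y \<in> T" "x \<notin> T \<or> z \<notin> T"
    "\<And>e. e \<in> edges G \<Longrightarrow> c e \<in> {b, g} \<Longrightarrow> ends G e \<subseteq> T \<or> ends G e \<inter> T = {}"
proof -
  define K where "K T = {e \<in> edges G. c e \<in> {b, g} \<and> ends G e \<subseteq> T}" for T
  have fK: "finite (K T)" for T using finite_edges by (simp add: K_def)
  define P where "P = {T. T \<subseteq> verts G \<and> y \<in> T \<and> card T \<le> card (K T) + 1}"
  have "finite P" using finite_verts by (intro finite_subset[of P "Pow (verts G)"]) (auto simp: P_def)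
  moreover have "{y} \<in> P" using y by (simp add: P_def)
  ultimately have "\<exists>T\<in>P. \<forall>S\<in>P. T \<subseteq> S \<longrightarrow> T = S" by (intro finite_has_maximal) auto
  then obtain T where TP: "T \<in> P" and max: "\<And>S. S \<in> P \<Longrightarrow> T \<subseteq> S \<Longrightarrow> T = S" by blast
  then have T: "T \<subseteq> verts G" "y \<in> T" "card T \<le> card (K T) + 1" by (auto simp: P_def)
  have fT: "finite T" using T(1) finite_verts finite_subset by blast
  have closed: "ends G e \<subseteq> T" if e: "e \<in> edges G" "c e \<in> {b, g}" "u \<in> ends G e" "u \<in> T" for e u
  proof -
    obtain v where v: "ends G e = {u, v}" "v \<in> verts G"
      using e(1,3) by (elim edge_endsE) (auto simp: insert_commute)
    show ?thesis
    proof (cases "v \<in> T")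
      case False
      have "insert e (K T) \<subseteq> K (insert v T)" using e v by (auto simp: K_def)
      moreover have "e \<notin> K T" using False v by (simp add: K_def)
      ultimately have "card (K T) + 1 \<le> card (K (insert v T))"
        using card_mono[OF fK, of "insert e (K T)" "insert v T"] fK by simp
      then have "insert v T \<in> P" using T v False fT by (simp add: P_def)
      then show ?thesis using max[of "insert v T"] False by blast
    qed (use v e in simp)
  qed
  have "x \<notin> T \<or> z \<notin> T"
  proof (rule ccontr)
    assume "\<not> ?thesis"
    then have xz: "x \<in> T" "z \<in> T" by auto
    have "K T = {e \<in> edges G. c e = b \<and> ends G e \<subseteq> T} \<union> {e \<in> edges G. c e = g \<and> ends G e \<subseteq> T}"
      by (auto simp: K_def)
    then have "card (K T) = card {e \<in> edges G. c e = b \<and> ends G e \<subseteq> T}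
        + card {e \<in> edges G. c e = g \<and> ends G e \<subseteq> T}"
      using finite_edges \<open>b \<noteq> g\<close> by (auto intro!: card_Un_disjoint)
    moreover have "2 * card {e \<in> edges G. c e = b \<and> ends G e \<subseteq> T} + card {y} \<le> card T"
      using T my by (intro colour_class_inside[OF c fT]) auto
    moreover have "2 * card {e \<in> edges G. c e = g \<and> ends G e \<subseteq> T} + card {x, z} \<le> card T"
      using xz mx mz by (intro colour_class_inside[OF c fT]) auto
    moreover have "card T \<le> card (K T) + 1" using T by simp
    ultimately show False using \<open>x \<noteq> z\<close> by simp
  qed
  then show ?thesis using that[of T] T closed by blast
qed

text \<open>Exchanging two colours on a union of Kempe components acts at each vertex as a permutation of
  all the colours seen there, hence keeps the colouring proper and permutes the missing colours.\<close>

lemma kempe_swap: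
  assumes c: "proper_edge_colouring G k c" and bg: "b < k" "g < k"
    and closed: "\<And>e. e \<in> edges G \<Longrightarrow> c e \<in> {b, g} \<Longrightarrow> ends G e \<subseteq> T \<or> ends G e \<inter> T = {}"
  obtains c' where "proper_edge_colouring G k c'"
    "\<And>e. c e \<notin> {b, g} \<Longrightarrow> c' e = c e"
    "\<And>v. missing G k c' v =
      (if v \<in> T then transpose b g ` missing G k c v else missing G k c v)"
proof -
  define c' where "c' e = (if ends G e \<inter> T \<noteq> {} then transpose b g (c e) else c e)" for e
  \<comment> \<open>An edge that leaves \<open>T\<close> has neither colour, so the transposition fixes it and either rule
    may be used for it.\<close>
  have at: "c' e = (if v \<in> T then transpose b g (c e) else c e)"
    if "e \<in> edges G" "v \<in> ends G e" for e v
    using closed[OF that(1)] that(2) by (auto simp: c'_def transpose_def)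
  have lt: "transpose b g i < k \<longleftrightarrow> i < k" for i
    using bg by (auto simp: transpose_def)
  have "proper_edge_colouring G k c'"
    unfolding proper_edge_colouring_def
  proof (intro conjI ballI impI)
    show "c' e < k" if "e \<in> edges G" for e
      using c that lt by (simp add: c'_def proper_edge_colouring_def)
    show "c' e \<noteq> c' f" if ef: "e \<in> edges G" "f \<in> edges G" "e \<noteq> f" "ends G e \<inter> ends G f \<noteq> {}" for e f
    proof -
      obtain v where v: "v \<in> ends G e" "v \<in> ends G f" using ef(4) by blast
      have "c e \<noteq> c f" using c ef by (simp add: proper_edge_colouring_def)
      moreover have "inj (transpose b g)" by (rule inj_on_transpose)
      ultimately show ?thesis
        unfolding at[OF ef(1) v(1)] at[OF ef(2) v(2)] by (simp add: inj_eq)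
    qed
  qed
  moreover have "c' e = c e" if "c e \<notin> {b, g}" for e
    using that by (simp add: c'_def)
  moreover have "missing G k c' v =
      (if v \<in> T then transpose b g ` missing G k c v else missing G k c v)" for v
  proof (cases "v \<in> T")
    case True
    have "i \<in> missing G k c' v \<longleftrightarrow> transpose b g i \<in> missing G k c v" for i
    proof -
      have "c' e \<noteq> i \<longleftrightarrow> c e \<noteq> transpose b g i" if "e \<in> edges G" "v \<in> ends G e" for e
        using at[OF that] True transpose_involutory[of b g "c e"] transpose_involutory[of b g i]
        by auto
      then show ?thesis unfolding missing_def mem_Collect_eq lt by blast
    qed
    then have "missing G k c' v = transpose b g -` missing G k c v" by blast
    also have "\<dots> = transpose b g ` missing G k c v"
      using bij_vimage_eq_inv_image[OF bij_transpose] by simp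
    finally show ?thesis using True by simp
  next
    case False
    have "c' e = c e" if "e \<in> edges G" "v \<in> ends G e" for e
      using at[OF that] False by simp
    then show ?thesis using False unfolding missing_def by auto
  qed
  ultimately show ?thesis using that by blast
qed

end

text \<open>The inductive step of Shannon's theorem. Let \<open>e = xy\<close> be the uncoloured edge and let \<open>a\<close> be
  missing at \<open>x\<close>. If \<open>a\<close> is missing at \<open>y\<close> too, it colours \<open>e\<close>; otherwise some edge \<open>f = yz\<close> has
  colour \<open>a\<close>. Both ends of \<open>e\<close> have a spare colour beyond the degree bound, so the missing sets
  of \<open>x\<close>, \<open>y\<close>, \<open>z\<close> have total size exceeding \<open>k\<close>, and two of them meet:
  those of \<open>x\<close> and \<open>y\<close> would colour \<open>e\<close>; those of \<open>y\<close> and \<open>z\<close> would recolour \<open>f\<close> and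
  release \<open>a\<close> for \<open>e\<close>; those of \<open>x\<close> and \<open>z\<close> are brought to one of these cases by a Kempe swap.\<close>

lemma (in fin_multigraph) extend_edge_colouring:
  assumes k: "3 * max_degree G \<le> 2 * k + 1"
    and F: "insert e F \<subseteq> edges G" "e \<notin> F"
    and c: "proper_edge_colouring (restrict_edges G F) k c"
  shows "\<exists>c'. proper_edge_colouring (restrict_edges G (insert e F)) k c'"
proof (rule ccontr)
  assume no: "\<not> ?thesis"
  let ?H = "restrict_edges G F"
  interpret H: fin_multigraph ?H
    using F finite_verts finite_edges ends_subset card_ends
    by unfold_locales (auto intro: finite_subset)
  define d where "d = max_degree G"
  obtain x y where e: "ends G e = {x, y}" "x \<noteq> y" "x \<in> verts G" "y \<in> verts G"
    using F by (auto elim: edge_endsE)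
  have deg: "degree ?H v \<le> d" if "v \<in> verts G" for v
  proof -
    have "degree ?H v \<le> degree G v"
      unfolding degree_def using F finite_edges by (intro card_mono) auto
    then show ?thesis using degree_le_max_degree[OF that] by (simp add: d_def)
  qed
  have deg_e: "degree ?H v + 1 \<le> d" if "v \<in> {x, y}" for v
  proof -
    have "insert e {f \<in> F. v \<in> ends G f} \<subseteq> {f \<in> edges G. v \<in> ends G f}"
      using F e that by auto
    from card_mono[OF _ this] have "degree ?H v + 1 \<le> degree G v"
      using F finite_edges finite_subset[of F "edges G"] by (simp add: degree_def)
    then show ?thesis using degree_le_max_degree[of v] that e by (auto simp: d_def)
  qed
  let ?M = "missing ?H k c"
  have xy: "?M x \<inter> ?M y = {}"
    using no colour_new_edge[OF c F(2) e(1)] by blast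
  have cx: "k + 1 \<le> card (?M x) + d" and cy: "k + 1 \<le> card (?M y) + d"
    using H.card_missing[OF c, of x] H.card_missing[OF c, of y] deg_e[of x] deg_e[of y] by auto
  have "d \<le> k" using deg_e[of x] k by (simp add: d_def)
  then obtain a where a: "a \<in> ?M x" using cx by fastforce
  then obtain f where f: "f \<in> F" "y \<in> ends G f" "c f = a"
    using xy by (auto simp: missing_def)
  have "f \<in> edges G" using f F by auto
  then obtain z where z: "ends G f = {y, z}" "y \<noteq> z" "z \<in> verts G"
    using f(2) by (elim edge_endsE) (auto simp: insert_commute)
  have "x \<noteq> z" using a f z by (auto simp: missing_def)
  \<comment> \<open>If \<open>y\<close> and \<open>z\<close> miss a common colour, \<open>e\<close> inherits the colour \<open>a\<close> of \<open>f\<close> and \<open>f\<close> takes that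
    common colour. This is needed both for \<open>c\<close> and for the colouring after the swap.\<close>
  have shift: False
    if c': "proper_edge_colouring ?H k c'" "c' f = a" "a \<in> missing ?H k c' x"
      and i: "i \<in> missing ?H k c' y" "i \<in> missing ?H k c' z" for c' i
  proof -
    let ?c = "c'(e := a)"
    let ?F = "insert e (F - {f})"
    have "f \<noteq> e" using f F by auto
    have 1: "proper_edge_colouring (restrict_edges G ?F) k ?c"
    proof (rule colour_new_edge[where x = x and y = y])
      show "proper_edge_colouring (restrict_edges G (F - {f})) k c'"
        using c'(1) by (simp add: proper_edge_colouring_def)
      show "a \<in> missing (restrict_edges G (F - {f})) k c' x"
        using c'(3) by (simp add: missing_def)
      show "a \<in> missing (restrict_edges G (F - {f})) k c' y"
        unfolding missing_def
      proof (intro CollectI conjI ballI impI)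
        show "a < k" using c'(3) by (simp add: missing_def)
        show "c' f' \<noteq> a"
          if "f' \<in> edges (restrict_edges G (F - {f}))" "y \<in> ends (restrict_edges G (F - {f})) f'" for f'
          using that c'(1,2) f(1,2) unfolding proper_edge_colouring_def by auto
      qed
    qed (use e F in auto)
    have ia: "i \<noteq> a" using i(1) f c'(2) by (auto simp: missing_def)
    have "proper_edge_colouring (restrict_edges G (insert f ?F)) k (?c(f := i))"
    proof (rule colour_new_edge[OF 1 _ z(1)])
      show "f \<notin> ?F" using \<open>f \<noteq> e\<close> by simp
      show "i \<in> missing (restrict_edges G ?F) k ?c y" "i \<in> missing (restrict_edges G ?F) k ?c z"
        using i ia by (auto simp: missing_def)
    qed
    moreover have "insert f ?F = insert e F" using f by auto
    ultimately show False using no by auto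
  qed
  have yz: "?M y \<inter> ?M z = {}"
    using shift[OF c f(3) a] by auto
  obtain g where g: "g \<in> ?M x" "g \<in> ?M z"
  proof (rule ccontr)
    assume "\<not> thesis"
    then have "?M x \<inter> ?M z = {}" using that by blast
    then have "card (?M x \<union> ?M y \<union> ?M z) = card (?M x) + card (?M y) + card (?M z)"
      using xy yz by (subst card_Un_disjoint; auto)+
    moreover have "card (?M x \<union> ?M y \<union> ?M z) \<le> card {..<k}"
      by (intro card_mono) (auto simp: missing_def)
    moreover have "k \<le> card (?M z) + d"
      using H.card_missing[OF c, of z] deg[OF z(3)] by simp
    ultimately show False using cx cy k \<open>d \<le> k\<close> by (simp add: d_def)
  qed
  obtain b where b: "b \<in> ?M y" using cy \<open>d \<le> k\<close> by fastforce
  have bg: "b \<noteq> g" "b < k" "g < k" using b g xy by (auto simp: missing_def)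
  obtain T where T: "y \<in> T" "x \<notin> T \<or> z \<notin> T"
    and closed: "\<And>e. e \<in> edges ?H \<Longrightarrow> c e \<in> {b, g} \<Longrightarrow> ends ?H e \<subseteq> T \<or> ends ?H e \<inter> T = {}"
    using H.kempe_separation[OF c _ \<open>x \<noteq> z\<close> bg(1) g b] e by auto
  obtain c' where c': "proper_edge_colouring ?H k c'" "\<And>e. c e \<notin> {b, g} \<Longrightarrow> c' e = c e"
    and m: "\<And>v. missing ?H k c' v = (if v \<in> T then transpose b g ` ?M v else ?M v)"
    using H.kempe_swap[OF c bg(2,3) closed] by blast
  \<comment> \<open>Swapping on the side of \<open>y\<close> makes \<open>g\<close> missing at \<open>y\<close>, while \<open>g\<close> stays missing at whichever
    of \<open>x\<close>, \<open>z\<close> lies outside \<open>T\<close>.\<close>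
  have gy: "g \<in> missing ?H k c' y" using m[of y] T b by (auto simp: image_iff intro!: bexI[of _ b])
  show False
  proof (cases "x \<in> T")
    case False
    then have "g \<in> missing ?H k c' x" using m[of x] g by simp
    then show False using no colour_new_edge[OF c'(1) F(2) e(1)] gy by blast
  next
    case True
    then have "g \<in> missing ?H k c' z" using m[of z] T g by simp
    moreover have a': "a \<noteq> b" "a \<noteq> g" using f b g z by (auto simp: missing_def)
    moreover have "a \<in> missing ?H k c' x"
      using m[of x] True a a' by (auto simp: image_iff intro!: bexI[of _ a])
    ultimately show False using shift[OF c'(1) _ _ gy] c'(2)[of f] f(3) by auto
  qed
qed

lemma (in fin_multigraph) shannon_edge_colouring:
  assumes "3 * max_degree G \<le> 2 * k + 1"
  shows "\<exists>c. proper_edge_colouring G k c"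
proof -
  have "\<exists>c. proper_edge_colouring (restrict_edges G F) k c" if "F \<subseteq> edges G" for F
    using finite_subset[OF that finite_edges] that
  proof (induction F rule: finite_induct)
    case empty
    show ?case by (simp add: proper_edge_colouring_def)
  next
    case (insert e F)
    then show ?case using extend_edge_colouring[OF assms, of e F] by auto
  qed
  from this[of "edges G"] show ?thesis by simp
qed

lemma (in fin_multigraph) optimal_edge_colouring:
  "\<exists>c. proper_edge_colouring G (edge_chromatic_number G) c"
  unfolding edge_chromatic_number_def
proof (rule LeastI_ex)
  have "\<exists>c. proper_edge_colouring G (2 * max_degree G) c"
    by (rule shannon_edge_colouring) simp
  then show "\<exists>k c. proper_edge_colouring G k c" by blast
qed

section \<open>Colourings of arcs\<close>

lemma is_arc_subarc_general:
  assumes "is_arc G n a" "i \<le> j" "j \<le> n"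
  shows "is_arc G (j - i) (subarc a i j)"
  using assms
  by (auto simp: is_arc_def subarc_def split: prod.splits dest!: in_set_takeD in_set_dropD)

lemma subarc_subarc:
  assumes "is_arc G n a" "i \<le> j" "j \<le> n" "p \<le> q" "i + q \<le> j"
  shows "subarc (subarc a i j) p q = subarc a (i + p) (i + q)"
  using assms by (auto simp: is_arc_def subarc_def drop_take min_def add.commute split: prod.splits)

lemma subarc_rev_arc_general:
  assumes "is_arc G n a" "i \<le> j" "j \<le> n"
  shows "subarc (rev_arc a) i j = rev_arc (subarc a (n - j) (n - i))"
  using assms
  by (auto simp: is_arc_def subarc_def rev_arc_def take_rev drop_rev drop_take Suc_diff_le
      split: prod.splits)

text \<open>A proper colouring of the \<open>l\<close>-link graph, phrased on arcs instead of on the two-element sets that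
  represent links.\<close>

definition arc_colouring ::
  "('v, 'e) multigraph \<Rightarrow> nat \<Rightarrow> nat \<Rightarrow> (('v, 'e) arc \<Rightarrow> nat) \<Rightarrow> bool" where
  "arc_colouring G l k h \<longleftrightarrow>
     (\<forall>a. is_arc G l a \<longrightarrow> h a < k \<and> h (rev_arc a) = h a) \<and>
     (\<forall>a. is_arc G (l + 1) a \<longrightarrow> h (subarc a 0 l) \<noteq> h (subarc a 1 (l + 1)))"

lemma arc_colouringD:
  assumes "arc_colouring G l k h"
  shows "is_arc G l a \<Longrightarrow> h a < k" "is_arc G l a \<Longrightarrow> h (rev_arc a) = h a"
    "is_arc G (l + 1) a \<Longrightarrow> h (subarc a 0 l) \<noteq> h (subarc a 1 (l + 1))"
  using assms unfolding arc_colouring_def by blast+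

lemma link_chromatic_number_le:
  assumes h: "arc_colouring G l k h"
  shows "link_chromatic_number l G \<le> k"
proof -
  define c where "c L = h (SOME a. a \<in> L)" for L
  have c: "c (link_of a) = h a" if "is_arc G l a" for a
  proof -
    have "(SOME b. b \<in> link_of a) \<in> link_of a"
      by (rule someI[of _ a]) (simp add: link_of_def)
    then show ?thesis using arc_colouringD(2)[OF h that] by (auto simp: c_def link_of_def)
  qed
  have "proper_colouring (link_graph l G) k c"
    unfolding proper_colouring_def
  proof (intro conjI ballI allI impI)
    fix L assume "L \<in> verts (link_graph l G)"
    then show "c L < k" using c arc_colouringD(1)[OF h] by (auto simp: link_graph_def links_def)
  next
    fix Q L R assume "Q \<in> edges (link_graph l G)" and e: "ends (link_graph l G) Q = {L, R}"
    then obtain a where a: "is_arc G (l + 1) a" "Q = link_of a"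
      by (auto simp: link_graph_def links_def)
    have "{L, R} = {link_of (subarc a 0 l), link_of (subarc a 1 (l + 1))}"
      using ends_link_graph[OF a(1)] e a(2) by simp
    then show "c L \<noteq> c R"
      using arc_colouringD(3)[OF h a(1)] c[OF is_arc_subarc(1)[OF a(1)]]
        c[OF is_arc_subarc(2)[OF a(1)]]
      by (auto simp: doubleton_eq_iff)
  qed
  then show ?thesis
    unfolding link_chromatic_number_def by (rule chromatic_number_le)
qed

lemma (in fin_multigraph) optimal_arc_colouring:
  "\<exists>h. arc_colouring G l (link_chromatic_number l G) h"
proof -
  interpret L: fin_multigraph "link_graph l G" by (rule fin_multigraph_link_graph)
  obtain c where c: "proper_colouring (link_graph l G) (link_chromatic_number l G) c"
    using L.optimal_colouring unfolding link_chromatic_number_def by blast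
  have "arc_colouring G l (link_chromatic_number l G) (\<lambda>a. c (link_of a))"
    unfolding arc_colouring_def
  proof (intro conjI allI impI)
    show "c (link_of a) < link_chromatic_number l G" if "is_arc G l a" for a
      using c that unfolding proper_colouring_def link_graph_def links_def
      by (simp del: split_paired_Ex) blast
    show "c (link_of (rev_arc a)) = c (link_of a)" for a
      by simp
    show "c (link_of (subarc a 0 l)) \<noteq> c (link_of (subarc a 1 (l + 1)))"
      if a: "is_arc G (l + 1) a" for a
    proof -
      have "link_of a \<in> edges (link_graph l G)"
        using a by (auto simp: link_graph_def links_def simp del: split_paired_Ex)
      then show ?thesis
        using c ends_link_graph[OF a] unfolding proper_colouring_def by blast
    qed
  qed
  then show ?thesis by blast
qed

lemma arc_colouring_0:
  assumes "proper_colouring G k c"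
  shows "arc_colouring G 0 k (\<lambda>a. c (hd (fst a)))"
  unfolding arc_colouring_def
proof (intro conjI allI impI)
  fix a assume "is_arc G 0 a"
  then obtain v where "a = ([v], [])" "v \<in> verts G"
    by (cases a) (auto simp: is_arc_def length_Suc_conv)
  then show "c (hd (fst a)) < k" "c (hd (fst (rev_arc a))) = c (hd (fst a))"
    using assms by (auto simp: proper_colouring_def rev_arc_def)
next
  fix a assume "is_arc G (0 + 1) a"
  then obtain u v e where "a = ([u, v], [e])" "e \<in> edges G" "ends G e = {u, v}"
    by (cases a) (auto simp: is_arc_def length_Suc_conv)
  then show "c (hd (fst (subarc a 0 0))) \<noteq> c (hd (fst (subarc a 1 (0 + 1))))"
    using assms by (auto simp: proper_colouring_def subarc_def)
qed

lemma arc_colouring_1: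
  assumes "proper_edge_colouring G k c"
  shows "arc_colouring G 1 k (\<lambda>a. c (hd (snd a)))"
  unfolding arc_colouring_def
proof (intro conjI allI impI)
  fix a assume "is_arc G 1 a"
  then obtain u v e where "a = ([u, v], [e])" "e \<in> edges G"
    by (cases a) (auto simp: is_arc_def length_Suc_conv)
  then show "c (hd (snd a)) < k" "c (hd (snd (rev_arc a))) = c (hd (snd a))"
    using assms by (auto simp: proper_edge_colouring_def rev_arc_def)
next
  fix a assume a: "is_arc G (1 + 1) a"
  then obtain u v w e f where uvw: "a = ([u, v, w], [e, f])"
    by (cases a) (auto simp: is_arc_def length_Suc_conv numeral_2_eq_2)
  then have "e \<in> edges G" "f \<in> edges G" "e \<noteq> f" "v \<in> ends G e" "v \<in> ends G f"
    using a by (auto simp: is_arc_def less_Suc_eq numeral_2_eq_2)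
  then have "c e \<noteq> c f" using assms unfolding proper_edge_colouring_def by blast
  then show "c (hd (snd (subarc a 0 1))) \<noteq> c (hd (snd (subarc a 1 (1 + 1))))"
    using uvw by (simp add: subarc_def)
qed

section \<open>From l-links to (l+2)-links\<close>

lemma arc_colouring_middle:
  assumes h: "arc_colouring G l k h"
  shows "arc_colouring G (l + 2) k (\<lambda>a. h (subarc a 1 (l + 1)))"
  unfolding arc_colouring_def
proof (intro conjI allI impI)
  fix a assume a: "is_arc G (l + 2) a"
  have m: "is_arc G l (subarc a 1 (l + 1))" using is_arc_subarc_general[OF a, of 1 "l + 1"] by simp
  then show "h (subarc a 1 (l + 1)) < k" by (rule arc_colouringD[OF h])
  show "h (subarc (rev_arc a) 1 (l + 1)) = h (subarc a 1 (l + 1))"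
    using subarc_rev_arc_general[OF a, of 1 "l + 1"] arc_colouringD(2)[OF h m] by simp
next
  fix a assume a: "is_arc G (l + 2 + 1) a"
  have "is_arc G (l + 1) (subarc a 1 (l + 2))" using is_arc_subarc_general[OF a, of 1 "l + 2"] by simp
  from arc_colouringD(3)[OF h this]
  show "h (subarc (subarc a 0 (l + 2)) 1 (l + 1)) \<noteq> h (subarc (subarc a 1 (l + 2 + 1)) 1 (l + 1))"
    using a by (simp add: subarc_subarc[OF a])
qed

text \<open>The new colour of an arc whose middle has colour \<open>b\<close> and whose two outer subarcs have colours
  \<open>p\<close> and \<open>q\<close>. The triples are \<open>3j + 1\<close>, \<open>3j + 2\<close>, \<open>3j + 3\<close>, the first two of which become \<open>2j + 1\<close>
  and \<open>2j + 2\<close>; the shared colour is \<open>0\<close>. It also serves the old colour \<open>0\<close>, which belongs to no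
  triple: starting the triples at \<open>1\<close> is what makes the number of new colours \<open>2 * k div 3 + 1\<close> for every
  residue of \<open>k\<close> modulo 3.\<close>

definition thin :: "nat \<Rightarrow> nat \<Rightarrow> nat \<Rightarrow> nat" where
  "thin p b q =
     (let j = (b - 1) div 3 in
      if b = 0 then 0
      else if b mod 3 = 1 then 2 * j + 1
      else if b mod 3 = 2 then 2 * j + 2
      else if b - 2 \<notin> {p, q} then 2 * j + 1
      else if b - 1 \<notin> {p, q} then 2 * j + 2
      else 0)"

lemma thin_commute: "thin p b q = thin q b p"
  by (simp only: thin_def insert_commute)

lemma nat_triple_cases:
  obtains "b = 0" | j where "b = 3 * j + 1" | j where "b = 3 * j + 2" | j where "b = 3 * j + (3::nat)"
proof -
  have "b = 0 \<or> (\<exists>j. b = 3 * j + 1) \<or> (\<exists>j. b = 3 * j + 2) \<or> (\<exists>j. b = 3 * j + 3)"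
    by presburger
  then show ?thesis using that by blast
qed

lemma thin_simps:
  "thin p 0 q = 0"
  "thin p (3 * j + 1) q = 2 * j + 1"
  "thin p (3 * j + 2) q = 2 * j + 2"
  "thin p (3 * j + 3) q =
     (if 3 * j + 1 \<notin> {p, q} then 2 * j + 1 else if 3 * j + 2 \<notin> {p, q} then 2 * j + 2 else 0)"
proof -
  have "(3 * j + 1) mod 3 = 1" "(3 * j + 2) mod 3 = 2" "(3 * j + 3) mod 3 = 0"
    "(3 * j + 1 - 1) div 3 = j" "(3 * j + 2 - 1) div 3 = j" "(3 * j + 3 - 1) div 3 = j"
    "3 * j + 3 - 2 = 3 * j + 1" "3 * j + 3 - 1 = 3 * j + 2"
    by presburger+
  then show "thin p 0 q = 0"
    "thin p (3 * j + 1) q = 2 * j + 1"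
    "thin p (3 * j + 2) q = 2 * j + 2"
    "thin p (3 * j + 3) q =
     (if 3 * j + 1 \<notin> {p, q} then 2 * j + 1 else if 3 * j + 2 \<notin> {p, q} then 2 * j + 2 else 0)"
    unfolding thin_def Let_def by auto
qed

lemma thin_less:
  assumes "b < k"
  shows "thin p b q < 2 * k div 3 + 1"
proof -
  have "2 * j + 2 \<le> 2 * k div 3" if "3 * j + 2 < k" for j using that by linarith
  moreover have "2 * j + 1 \<le> 2 * k div 3" if "3 * j + 1 < k" for j using that by linarith
  ultimately show ?thesis
    using assms by (cases b rule: nat_triple_cases) (simp_all only: thin_simps split: if_split, force+)
qed

text \<open>Kept colours are renumbered injectively, so an abolished one, say \<open>b = 3j + 3\<close>, must be
  involved. If it becomes \<open>2j + 1\<close> or \<open>2j + 2\<close>, then \<open>q\<close> is not the old colour of that number, and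
  other abolished colours use only \<open>0\<close> and the numbers of their own triples. If it becomes \<open>0\<close>,
  then \<open>p\<close> and \<open>q\<close> are \<open>3j + 1\<close> and \<open>3j + 2\<close> in some order, so \<open>q\<close> is kept, with a positive number.
  The same holds with the two middles exchanged.\<close>

lemma thin_neq:
  assumes "b \<noteq> q"
  shows "thin p b q \<noteq> thin b q r"
proof -
  have parity: "2 * i + 1 \<noteq> 2 * j + (2::nat)" for i j by presburger
  show ?thesis
    using assms parity parity[symmetric]
    by (cases b rule: nat_triple_cases; cases q rule: nat_triple_cases)
      (simp_all only: thin_simps split: if_split, auto)
qed

lemma arc_colouring_thin:
  assumes h: "arc_colouring G l k h"
  shows "arc_colouring G (l + 2) (2 * k div 3 + 1)
    (\<lambda>a. thin (h (subarc a 0 l)) (h (subarc a 1 (l + 1))) (h (subarc a 2 (l + 2))))"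
  unfolding arc_colouring_def
proof (intro conjI allI impI)
  fix a assume a: "is_arc G (l + 2) a"
  have m: "is_arc G l (subarc a i (l + i))" if "i \<le> 2" for i
    using is_arc_subarc_general[OF a, of i "l + i"] that by simp
  have r: "h (subarc (rev_arc a) i (l + i)) = h (subarc a (2 - i) (l + (2 - i)))" if "i \<le> 2" for i
    using subarc_rev_arc_general[OF a, of i "l + i"] arc_colouringD(2)[OF h m[of "2 - i"]] that
    by simp
  show "thin (h (subarc a 0 l)) (h (subarc a 1 (l + 1))) (h (subarc a 2 (l + 2))) < 2 * k div 3 + 1"
    using m[of 1] by (intro thin_less arc_colouringD[OF h]) simp
  show "thin (h (subarc (rev_arc a) 0 l)) (h (subarc (rev_arc a) 1 (l + 1)))
      (h (subarc (rev_arc a) 2 (l + 2))) =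
    thin (h (subarc a 0 l)) (h (subarc a 1 (l + 1))) (h (subarc a 2 (l + 2)))"
    using r[of 0] r[of 1] r[of 2] by (simp add: thin_commute)
next
  fix a assume a: "is_arc G (l + 2 + 1) a"
  have "is_arc G (l + 1) (subarc a 1 (l + 2))" using is_arc_subarc_general[OF a, of 1 "l + 2"] by simp
  from arc_colouringD(3)[OF h this]
  have neq: "h (subarc a 1 (l + 1)) \<noteq> h (subarc a 2 (l + 2))"
    by (simp add: subarc_subarc[OF a] numeral_2_eq_2)
  have sub: "subarc (subarc a 0 (l + 2)) i (l + i) = subarc a i (l + i)"
    "subarc (subarc a 1 (l + 2 + 1)) i (l + i) = subarc a (i + 1) (l + i + 1)" if "i \<le> 2" for i
    using that by (simp_all add: subarc_subarc[OF a])
  have "subarc (subarc a 0 (l + 2)) 1 (l + 1) = subarc a 1 (l + 1)"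
    "subarc (subarc a 0 (l + 2)) 2 (l + 2) = subarc a 2 (l + 2)"
    "subarc (subarc a 1 (l + 2 + 1)) 0 l = subarc a 1 (l + 1)"
    "subarc (subarc a 1 (l + 2 + 1)) 1 (l + 1) = subarc a 2 (l + 2)"
    using sub[of 0] sub[of 1] sub(1)[of 2] by (simp_all add: numeral_2_eq_2)
  then show "thin (h (subarc (subarc a 0 (l + 2)) 0 l)) (h (subarc (subarc a 0 (l + 2)) 1 (l + 1)))
      (h (subarc (subarc a 0 (l + 2)) 2 (l + 2))) \<noteq>
    thin (h (subarc (subarc a 1 (l + 2 + 1)) 0 l)) (h (subarc (subarc a 1 (l + 2 + 1)) 1 (l + 1)))
      (h (subarc (subarc a 1 (l + 2 + 1)) 2 (l + 2)))"
    using thin_neq[OF neq] by (simp only: simp_thms)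
qed

context fin_multigraph
begin

lemma link_chromatic_number_mono:
  "link_chromatic_number (l + 2 * n) G \<le> link_chromatic_number l G"
proof (induction n)
  case (Suc n)
  have "link_chromatic_number (l + 2 * n + 2) G \<le> link_chromatic_number (l + 2 * n) G"
    using optimal_arc_colouring arc_colouring_middle link_chromatic_number_le by blast
  then show ?case using Suc by simp
qed simp

lemma link_chromatic_number_thin:
  "link_chromatic_number (l + 2) G \<le> 2 * link_chromatic_number l G div 3 + 1"
  using optimal_arc_colouring arc_colouring_thin link_chromatic_number_le by blast

lemma link_chromatic_number_decay:
  assumes "link_chromatic_number l G \<le> k"
  shows "int (link_chromatic_number (l + 2 * n) G)
    \<le> min (int k) (\<lfloor>(2 / 3 :: real) ^ n * (real k - 3)\<rfloor> + 3)"
proof -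
  have "real (link_chromatic_number (l + 2 * n) G) - 3 \<le> (2 / 3) ^ n * (real k - 3)"
  proof (induction n)
    case 0
    show ?case using assms by simp
  next
    case (Suc n)
    have "3 * link_chromatic_number (l + 2 * n + 2) G \<le> 2 * link_chromatic_number (l + 2 * n) G + 3"
      using link_chromatic_number_thin[of "l + 2 * n"] by linarith
    then have "real (link_chromatic_number (l + 2 * Suc n) G) - 3
        \<le> 2 / 3 * (real (link_chromatic_number (l + 2 * n) G) - 3)"
      by simp
    also have "\<dots> \<le> 2 / 3 * ((2 / 3) ^ n * (real k - 3))"
      using Suc by (intro mult_left_mono) auto
    finally show ?case by (simp add: mult.assoc)
  qed
  then have "int (link_chromatic_number (l + 2 * n) G) - 3 \<le> \<lfloor>(2 / 3 :: real) ^ n * (real k - 3)\<rfloor>"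
    by (simp add: le_floor_iff)
  then show ?thesis
    using link_chromatic_number_mono[of l n] assms by simp
qed

lemma link_chromatic_number_0: "link_chromatic_number 0 G \<le> chromatic_number G"
proof -
  obtain c where "proper_colouring G (chromatic_number G) c" using optimal_colouring ..
  from link_chromatic_number_le[OF arc_colouring_0[OF this]] show ?thesis .
qed

lemma link_chromatic_number_1: "link_chromatic_number 1 G \<le> edge_chromatic_number G"
proof -
  obtain c where "proper_edge_colouring G (edge_chromatic_number G) c"
    using optimal_edge_colouring ..
  from link_chromatic_number_le[OF arc_colouring_1[OF this]] show ?thesis .
qed

text \<open>From \<open>\<lfloor>3\<Delta>/2\<rfloor>\<close> colours, thinning leaves at most \<open>2/3 \<cdot> 3\<Delta>/2 + 1 = \<Delta> + 1\<close>. This is where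
  \<open>l = 1\<close> is exceptional: before any thinning only the weaker Shannon bound holds.\<close>

lemma link_chromatic_number_3: "link_chromatic_number 3 G \<le> max_degree G + 1"
proof -
  have "3 * max_degree G \<le> 2 * (3 * max_degree G div 2) + 1" by linarith
  then obtain c where "proper_edge_colouring G (3 * max_degree G div 2) c"
    using shannon_edge_colouring by blast
  from link_chromatic_number_le[OF arc_colouring_thin[OF arc_colouring_1[OF this]]]
  have "link_chromatic_number 3 G \<le> 2 * (3 * max_degree G div 2) div 3 + 1"
    by (simp only: one_plus_numeral add_num_simps)
  then show ?thesis by linarith
qed

lemma link_chromatic_number_le_max_degree:
  assumes "l \<noteq> 1"
  shows "link_chromatic_number l G \<le> max_degree G + 1"
proof (cases "even l")
  case True
  then obtain n where "l = 2 * n" by blast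
  then show ?thesis
    using link_chromatic_number_mono[of 0 n] link_chromatic_number_0 chromatic_number_le_max_degree
    by simp
next
  case False
  then have "\<exists>n. l = 3 + 2 * n" using assms by presburger
  then obtain n where "l = 3 + 2 * n" by blast
  then show ?thesis
    using link_chromatic_number_mono[of 3 n] link_chromatic_number_3 by simp
qed

end

theorem theorem1p1:
  fixes G :: "('v, 'e) multigraph"
  assumes "fin_multigraph G"
  shows "(\<forall>l. even l \<longrightarrow>
            int (link_chromatic_number l G) \<le>
              min (int (chromatic_number G))
                (\<lfloor>(2 / 3 :: real) ^ (l div 2) * (real (chromatic_number G) - 3)\<rfloor> + 3))
       \<and> (\<forall>l. odd l \<longrightarrow>
            int (link_chromatic_number l G) \<le>
              min (int (edge_chromatic_number G))
                (\<lfloor>(2 / 3 :: real) ^ ((l - 1) div 2) * (real (edge_chromatic_number G) - 3)\<rfloor> + 3))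
       \<and> (\<forall>l. l \<noteq> 1 \<longrightarrow> link_chromatic_number l G \<le> max_degree G + 1)
       \<and> (\<forall>l\<ge>2. link_chromatic_number l G \<le> link_chromatic_number (l - 2) G)"
proof (intro conjI allI impI)
  interpret fin_multigraph G by (rule assms)
  fix l :: nat
  show "int (link_chromatic_number l G) \<le>
      min (int (chromatic_number G))
        (\<lfloor>(2 / 3 :: real) ^ (l div 2) * (real (chromatic_number G) - 3)\<rfloor> + 3)" if "even l"
    using link_chromatic_number_decay[OF link_chromatic_number_0, of "l div 2"]
    by (simp only: add_0 dvd_mult_div_cancel[OF that])
  show "int (link_chromatic_number l G) \<le>
      min (int (edge_chromatic_number G))
        (\<lfloor>(2 / 3 :: real) ^ ((l - 1) div 2) * (real (edge_chromatic_number G) - 3)\<rfloor> + 3)"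
    if "odd l"
  proof -
    have "1 + 2 * ((l - 1) div 2) = l" using that by presburger
    then show ?thesis
      using link_chromatic_number_decay[OF link_chromatic_number_1, of "(l - 1) div 2"] by (simp only:)
  qed
  show "link_chromatic_number l G \<le> max_degree G + 1" if "l \<noteq> 1"
    using that by (rule link_chromatic_number_le_max_degree)
  show "link_chromatic_number l G \<le> link_chromatic_number (l - 2) G" if "2 \<le> l"
  proof -
    have "l - 2 + 2 * 1 = l" using that by simp
    then show ?thesis using link_chromatic_number_mono[of "l - 2" 1] by (simp only:)
  qed
qed

end
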